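(* Let $\mathcal{M}$ be a convex subring of $^*\mathbb{C}$ with maximal ideal $\mathcal{M}_0$, let $\widehat{\mathcal{M}}=\mathcal{M}/\mathcal{M}_0$ be its asymptotic field, $q_{\mathcal{M}}:\mathcal{M}\to\widehat{\mathcal{M}}$ the quotient mapping, and let $\mathbb{M}$ be a maximal field in $\mathcal{M}$. Then the restriction $q_{\mathcal{M}}|\mathbb{M}:\mathbb{M}\to\widehat{\mathcal{M}}$, $z\mapsto\widehat{z}$, is a field isomorphism from $\mathbb{M}$ onto $\widehat{\mathcal{M}}$ (so $\widehat{\mathcal{M}}=q_{\mathcal{M}}[\mathbb{M}]$). Consequently, every asymptotic field $\widehat{\mathcal{M}}$ is an algebraically closed field, and its real part $q_{\mathcal{M}}[{}^*\mathbb{R}\cap\mathcal{M}]$ is a real closed field.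
   Context: $^*\mathbb{R}$ denotes a nonstandard extension of $\mathbb{R}$ in the sense of A. Robinson (an ultrapower $\mathbb{R}^{\mathcal{I}}/\mathcal{U}$, where $\mathcal{U}$ is an ultrafilter on an infinite set $\mathcal{I}$ containing a decreasing sequence of sets with empty intersection), and $^*\mathbb{C}={}^*\mathbb{R}(i)$, with the absolute value $|\cdot|:{}^*\mathbb{C}\to{}^*\mathbb{R}$; $\mathbb{C}\subset{}^*\mathbb{C}$ via constant families. Rings have an identity and subrings contain it. A subring $\mathcal{M}$ of $^*\mathbb{C}$ is convex if for all $z\in{}^*\mathbb{C}$ and $\zeta\in\mathcal{M}$, $|z|\le|\zeta|$ implies $z\in\mathcal{M}$. The set of non-invertible elements $\mathcal{M}_0=\{z\in\mathcal{M}: z=0\text{ or }1/z\notin\mathcal{M}\}$ is a maximal ideal of $\mathcal{M}$. The asymptotic field generated by $\mathcal{M}$ is $\widehat{\mathcal{M}}=\mathcal{M}/\mathcal{M}_0$; its real part $q_{\mathcal{M}}[{}^*\mathbb{R}\cap\mathcal{M}]$ is ordered by: $\widehat{x}>0$ iff $\widehat{x}\ne0$ and $x>0$ in $^*\mathbb{R}$. A subfield $\mathbb{M}$ of $^*\mathbb{C}$ is called a maximal field in $\mathcal{M}$ if $\mathbb{C}\subseteq\mathbb{M}\subseteq\mathcal{M}$ and no subfield of $^*\mathbb{C}$ contained in $\mathcal{M}$ is a proper extension of $\mathbb{M}$. *)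

theory Defs
  imports Complex_Main "HOL-Algebra.Algebraic_Closure"
begin

section \<open>Ultrapowers\<close>

text \<open>
  The index set is the type of indices itself; it is arbitrary since the type is a variable.
  The ultrafilter is a filter in the sense of the library: a set \<open>S\<close> of indices belongs to it iff
  \<open>\<forall>\<^sub>F i in U. i \<in> S\<close>.
\<close>

definition is_ultrafilter :: "'i filter \<Rightarrow> bool"
  where "is_ultrafilter U \<longleftrightarrow>
    U \<noteq> bot \<and> (\<forall>S. (\<forall>\<^sub>F i in U. i \<in> S) \<or> (\<forall>\<^sub>F i in U. i \<notin> S))"

definition robinson_ultrafilter :: "'i filter \<Rightarrow> bool"
  where "robinson_ultrafilter U \<longleftrightarrow>
    infinite (UNIV :: 'i set) \<and> is_ultrafilter U \<and>
    (\<exists>A :: nat \<Rightarrow> 'i set. decseq A \<and> (\<forall>n. \<forall>\<^sub>F i in U. i \<in> A n) \<and> (\<Inter>n. A n) = {})"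

definition family_class :: "'i filter \<Rightarrow> ('i \<Rightarrow> 'a) \<Rightarrow> ('i \<Rightarrow> 'a) set"
  where "family_class U f = {g. \<forall>\<^sub>F i in U. g i = f i}"

definition star_map :: "'i filter \<Rightarrow> ('a \<Rightarrow> 'b) \<Rightarrow> ('i \<Rightarrow> 'a) set \<Rightarrow> ('i \<Rightarrow> 'b) set"
  where "star_map U h x = (\<Union>f\<in>x. family_class U (\<lambda>i. h (f i)))"

definition star_map2 ::
    "'i filter \<Rightarrow> ('a \<Rightarrow> 'b \<Rightarrow> 'c) \<Rightarrow> ('i \<Rightarrow> 'a) set \<Rightarrow> ('i \<Rightarrow> 'b) set \<Rightarrow> ('i \<Rightarrow> 'c) set"
  where "star_map2 U h x y = (\<Union>f\<in>x. \<Union>g\<in>y. family_class U (\<lambda>i. h (f i) (g i)))"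

definition star_rel ::
    "'i filter \<Rightarrow> ('a \<Rightarrow> 'b \<Rightarrow> bool) \<Rightarrow> ('i \<Rightarrow> 'a) set \<Rightarrow> ('i \<Rightarrow> 'b) set \<Rightarrow> bool"
  where "star_rel U R x y \<longleftrightarrow> (\<exists>f\<in>x. \<exists>g\<in>y. \<forall>\<^sub>F i in U. R (f i) (g i))"

definition ultrapower :: "'i filter \<Rightarrow> ('i \<Rightarrow> 'a::field) set ring"
  where "ultrapower U =
    \<lparr>carrier = range (family_class U),
     monoid.mult = star_map2 U (*),
     one = family_class U (\<lambda>_. 1),
     zero = family_class U (\<lambda>_. 0),
     add = star_map2 U (+)\<rparr>"

abbreviation star_real :: "'i filter \<Rightarrow> ('i \<Rightarrow> real) set ring"
  where "star_real U \<equiv> ultrapower U"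

text \<open>
  The nonstandard complex numbers are rendered as the ultrapower of the complex numbers; the lemma
  \<open>star_complex_cartesian\<close> below shows that this is the extension of \<open>star_real U\<close> by the
  imaginary unit, and \<open>star_cmod_square\<close> that the absolute value is the usual one.
\<close>

abbreviation star_complex :: "'i filter \<Rightarrow> ('i \<Rightarrow> complex) set ring"
  where "star_complex U \<equiv> ultrapower U"

abbreviation star_cmod :: "'i filter \<Rightarrow> ('i \<Rightarrow> complex) set \<Rightarrow> ('i \<Rightarrow> real) set"
  where "star_cmod U \<equiv> star_map U cmod"

abbreviation star_complex_of_real :: "'i filter \<Rightarrow> ('i \<Rightarrow> real) set \<Rightarrow> ('i \<Rightarrow> complex) set"
  where "star_complex_of_real U \<equiv> star_map U complex_of_real"

definition standard_complex :: "'i filter \<Rightarrow> ('i \<Rightarrow> complex) set set"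
  where "standard_complex U = range (\<lambda>c. family_class U (\<lambda>_. c))"


section \<open>Convex subrings, asymptotic fields, maximal fields\<close>

definition convex_subring :: "'i filter \<Rightarrow> ('i \<Rightarrow> complex) set set \<Rightarrow> bool"
  where "convex_subring U M \<longleftrightarrow>
    subring M (star_complex U) \<and>
    (\<forall>z \<in> carrier (star_complex U). \<forall>\<zeta> \<in> M.
        star_rel U (\<le>) (star_cmod U z) (star_cmod U \<zeta>) \<longrightarrow> z \<in> M)"

definition noninvertibles :: "'i filter \<Rightarrow> ('i \<Rightarrow> complex) set set \<Rightarrow> ('i \<Rightarrow> complex) set set"
  where "noninvertibles U M =
    {z \<in> M. z = \<zero>\<^bsub>star_complex U\<^esub> \<or> inv\<^bsub>star_complex U\<^esub> z \<notin> M}"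

definition asymptotic_field ::
    "'i filter \<Rightarrow> ('i \<Rightarrow> complex) set set \<Rightarrow> ('i \<Rightarrow> complex) set set ring"
  where "asymptotic_field U M = (star_complex U)\<lparr>carrier := M\<rparr> Quot noninvertibles U M"

definition quotient_map ::
    "'i filter \<Rightarrow> ('i \<Rightarrow> complex) set set \<Rightarrow> ('i \<Rightarrow> complex) set \<Rightarrow> ('i \<Rightarrow> complex) set set"
  where "quotient_map U M z = noninvertibles U M +>\<^bsub>(star_complex U)\<lparr>carrier := M\<rparr>\<^esub> z"

definition maximal_field ::
    "'i filter \<Rightarrow> ('i \<Rightarrow> complex) set set \<Rightarrow> ('i \<Rightarrow> complex) set set \<Rightarrow> bool"
  where "maximal_field U M K \<longleftrightarrow>
    subfield K (star_complex U) \<and> standard_complex U \<subseteq> K \<and> K \<subseteq> M \<and>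
    \<not> (\<exists>L. subfield L (star_complex U) \<and> L \<subseteq> M \<and> K \<subset> L)"

definition asymptotic_real_part ::
    "'i filter \<Rightarrow> ('i \<Rightarrow> complex) set set \<Rightarrow> ('i \<Rightarrow> complex) set set ring"
  where "asymptotic_real_part U M =
    (asymptotic_field U M)\<lparr>carrier :=
      quotient_map U M ` (star_complex_of_real U ` carrier (star_real U) \<inter> M)\<rparr>"

definition asymptotic_positive ::
    "'i filter \<Rightarrow> ('i \<Rightarrow> complex) set set \<Rightarrow> ('i \<Rightarrow> complex) set set set"
  where "asymptotic_positive U M =
    {quotient_map U M (star_complex_of_real U x) | x.
       x \<in> carrier (star_real U) \<and> star_complex_of_real U x \<in> M \<and>
       quotient_map U M (star_complex_of_real U x) \<noteq> \<zero>\<^bsub>asymptotic_field U M\<^esub> \<and>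
       star_rel U (<) \<zero>\<^bsub>star_real U\<^esub> x}"


section \<open>Real closed fields\<close>

text \<open>The ordering of a field is given by its set \<open>P\<close> of positive elements.\<close>

locale totally_ordered_field = field R for R (structure) +
  fixes P :: "'a set"
  assumes pos_carrier: "P \<subseteq> carrier R"
    and zero_not_pos: "\<zero> \<notin> P"
    and pos_or_neg: "\<lbrakk>x \<in> carrier R; x \<noteq> \<zero>\<rbrakk> \<Longrightarrow> x \<in> P \<or> \<ominus> x \<in> P"
    and not_pos_and_neg: "x \<in> P \<Longrightarrow> \<ominus> x \<notin> P"
    and pos_add: "\<lbrakk>x \<in> P; y \<in> P\<rbrakk> \<Longrightarrow> x \<oplus> y \<in> P"
    and pos_mult: "\<lbrakk>x \<in> P; y \<in> P\<rbrakk> \<Longrightarrow> x \<otimes> y \<in> P"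

locale real_closed_field = totally_ordered_field +
  assumes pos_square: "x \<in> P \<Longrightarrow> \<exists>y \<in> carrier R. y \<otimes> y = x"
    and odd_degree_root:
      "\<lbrakk>p \<in> carrier (poly_ring R); odd (degree p)\<rbrakk> \<Longrightarrow> \<exists>x \<in> carrier R. eval p x = \<zero>"


section \<open>Basic facts about ultrapowers\<close>

lemma family_class_eq_iff:
  "family_class U f = family_class U g \<longleftrightarrow> (\<forall>\<^sub>F i in U. f i = g i)"
proof
  assume "family_class U f = family_class U g"
  moreover have "f \<in> family_class U f"
    by (simp add: family_class_def)
  ultimately show "\<forall>\<^sub>F i in U. f i = g i"
    by (simp add: family_class_def)
next
  assume fg: "\<forall>\<^sub>F i in U. f i = g i"
  show "family_class U f = family_class U g"
    unfolding family_class_def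
    by (auto elim!: eventually_elim2[OF _ fg])
qed

lemma star_map_family_class:
  "star_map U h (family_class U f) = family_class U (\<lambda>i. h (f i))"
proof -
  have "family_class U (\<lambda>i. h (g i)) = family_class U (\<lambda>i. h (f i))"
    if "g \<in> family_class U f" for g
    using that unfolding family_class_eq_iff by (auto simp: family_class_def elim: eventually_mono)
  moreover have "f \<in> family_class U f"
    by (simp add: family_class_def)
  ultimately show ?thesis
    unfolding star_map_def by blast
qed

lemma star_map2_family_class:
  "star_map2 U h (family_class U f) (family_class U g) = family_class U (\<lambda>i. h (f i) (g i))"
proof -
  have "family_class U (\<lambda>i. h (f' i) (g' i)) = family_class U (\<lambda>i. h (f i) (g i))"
    if "f' \<in> family_class U f" "g' \<in> family_class U g" for f' g'
    using that unfolding family_class_eq_iff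
    by (auto simp: family_class_def elim: eventually_elim2)
  moreover have "f \<in> family_class U f" "g \<in> family_class U g"
    by (simp_all add: family_class_def)
  ultimately show ?thesis
    unfolding star_map2_def by blast
qed

lemma star_rel_family_class:
  "star_rel U R (family_class U f) (family_class U g) \<longleftrightarrow> (\<forall>\<^sub>F i in U. R (f i) (g i))"
proof
  assume "star_rel U R (family_class U f) (family_class U g)"
  then obtain f' g' where "\<forall>\<^sub>F i in U. f' i = f i" "\<forall>\<^sub>F i in U. g' i = g i"
    "\<forall>\<^sub>F i in U. R (f' i) (g' i)"
    by (auto simp: star_rel_def family_class_def)
  then show "\<forall>\<^sub>F i in U. R (f i) (g i)"
    by eventually_elim simp
next
  assume "\<forall>\<^sub>F i in U. R (f i) (g i)"
  then show "star_rel U R (family_class U f) (family_class U g)"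
    unfolding star_rel_def family_class_def by (intro bexI[of _ f] bexI[of _ g]) auto
qed

lemma ultrapower_simps:
  "carrier (ultrapower U) = range (family_class U)"
  "family_class U f \<otimes>\<^bsub>ultrapower U\<^esub> family_class U g = family_class U (\<lambda>i. f i * g i)"
  "family_class U f \<oplus>\<^bsub>ultrapower U\<^esub> family_class U g = family_class U (\<lambda>i. f i + g i)"
  "\<one>\<^bsub>ultrapower U\<^esub> = family_class U (\<lambda>_. 1)"
  "\<zero>\<^bsub>ultrapower U\<^esub> = family_class U (\<lambda>_. 0)"
  by (simp_all add: ultrapower_def star_map2_family_class)

lemma field_ultrapower:
  assumes "is_ultrafilter U"
  shows "field (ultrapower U :: ('i \<Rightarrow> 'a::field) set ring)"
proof -
  let ?S = "ultrapower U :: ('i \<Rightarrow> 'a) set ring"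
  have "cring ?S"
  proof (rule cringI)
    show "abelian_group ?S"
    proof (rule abelian_groupI)
      fix x assume "x \<in> carrier ?S"
      then obtain f where x: "x = family_class U f"
        by (auto simp: ultrapower_simps)
      show "\<exists>y\<in>carrier ?S. y \<oplus>\<^bsub>?S\<^esub> x = \<zero>\<^bsub>?S\<^esub>"
        by (rule bexI[of _ "family_class U (\<lambda>i. - f i)"]) (auto simp: x ultrapower_simps)
    qed (auto simp: ultrapower_simps add_ac)
    show "Group.comm_monoid ?S"
      by (rule comm_monoidI) (auto simp: ultrapower_simps mult_ac)
  qed (auto simp: ultrapower_simps algebra_simps)
  then interpret cring ?S .
  have "\<one>\<^bsub>?S\<^esub> \<noteq> \<zero>\<^bsub>?S\<^esub>"
    using assms by (simp add: ultrapower_simps family_class_eq_iff is_ultrafilter_def)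
  moreover have "\<exists>y\<in>carrier ?S. x \<otimes>\<^bsub>?S\<^esub> y = \<one>\<^bsub>?S\<^esub>"
    if x: "x \<in> carrier ?S" "x \<noteq> \<zero>\<^bsub>?S\<^esub>" for x
  proof -
    obtain f where f: "x = family_class U f"
      using x by (auto simp: ultrapower_simps)
    have "(\<forall>\<^sub>F i in U. i \<in> {i. f i = 0}) \<or> (\<forall>\<^sub>F i in U. i \<notin> {i. f i = 0})"
      using assms unfolding is_ultrafilter_def by blast
    with x have "\<forall>\<^sub>F i in U. f i \<noteq> 0"
      by (auto simp: f ultrapower_simps family_class_eq_iff)
    then have "x \<otimes>\<^bsub>?S\<^esub> family_class U (\<lambda>i. inverse (f i)) = \<one>\<^bsub>?S\<^esub>"
      by (auto simp: f ultrapower_simps family_class_eq_iff elim: eventually_mono)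
    then show ?thesis
      by (auto simp: ultrapower_simps)
  qed
  ultimately show ?thesis
    by (intro cring_fieldI2) auto
qed

lemma star_complex_cartesian:
  assumes "z \<in> carrier (star_complex U)"
  shows "\<exists>!(a, b). a \<in> carrier (star_real U) \<and> b \<in> carrier (star_real U) \<and>
    z = star_complex_of_real U a \<oplus>\<^bsub>star_complex U\<^esub>
        family_class U (\<lambda>_. \<i>) \<otimes>\<^bsub>star_complex U\<^esub> star_complex_of_real U b"
proof -
  obtain f where f: "z = family_class U f"
    using assms by (auto simp: ultrapower_simps)
  show ?thesis
  proof (rule ex1I[of _ "(family_class U (\<lambda>i. Re (f i)), family_class U (\<lambda>i. Im (f i)))"])
    show "case (family_class U (\<lambda>i. Re (f i)), family_class U (\<lambda>i. Im (f i))) of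
      (a, b) \<Rightarrow> a \<in> carrier (star_real U) \<and> b \<in> carrier (star_real U) \<and>
        z = star_complex_of_real U a \<oplus>\<^bsub>star_complex U\<^esub>
          family_class U (\<lambda>_. \<i>) \<otimes>\<^bsub>star_complex U\<^esub> star_complex_of_real U b"
      by (simp add: f ultrapower_simps star_map_family_class complex_eq[symmetric])
  next
    fix p :: "('a \<Rightarrow> real) set \<times> ('a \<Rightarrow> real) set"
    assume "case p of (a, b) \<Rightarrow> a \<in> carrier (star_real U) \<and> b \<in> carrier (star_real U) \<and>
      z = star_complex_of_real U a \<oplus>\<^bsub>star_complex U\<^esub>
        family_class U (\<lambda>_. \<i>) \<otimes>\<^bsub>star_complex U\<^esub> star_complex_of_real U b"
    then obtain g h where p: "p = (family_class U g, family_class U h)"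
      and "z = star_complex_of_real U (family_class U g) \<oplus>\<^bsub>star_complex U\<^esub>
        family_class U (\<lambda>_. \<i>) \<otimes>\<^bsub>star_complex U\<^esub> star_complex_of_real U (family_class U h)"
      unfolding ultrapower_simps(1) by blast
    then have "\<forall>\<^sub>F i in U. f i = complex_of_real (g i) + \<i> * complex_of_real (h i)"
      by (simp add: f ultrapower_simps star_map_family_class family_class_eq_iff)
    then have "\<forall>\<^sub>F i in U. g i = Re (f i)" "\<forall>\<^sub>F i in U. h i = Im (f i)"
      by (auto elim: eventually_mono)
    then show "p = (family_class U (\<lambda>i. Re (f i)), family_class U (\<lambda>i. Im (f i)))"
      by (simp add: p family_class_eq_iff)
  qed
qed

lemma star_cmod_square:
  assumes "a \<in> carrier (star_real U)" "b \<in> carrier (star_real U)"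
    and "z = star_complex_of_real U a \<oplus>\<^bsub>star_complex U\<^esub>
      family_class U (\<lambda>_. \<i>) \<otimes>\<^bsub>star_complex U\<^esub> star_complex_of_real U b"
  shows "star_cmod U z \<otimes>\<^bsub>star_real U\<^esub> star_cmod U z =
      a \<otimes>\<^bsub>star_real U\<^esub> a \<oplus>\<^bsub>star_real U\<^esub> b \<otimes>\<^bsub>star_real U\<^esub> b"
    and "star_rel U (\<le>) \<zero>\<^bsub>star_real U\<^esub> (star_cmod U z)"
proof -
  obtain f g where fg: "a = family_class U f" "b = family_class U g"
    using assms by (auto simp: ultrapower_simps)
  have *: "cmod (complex_of_real x + \<i> * complex_of_real y) *
      cmod (complex_of_real x + \<i> * complex_of_real y) = x * x + y * y" for x y
    by (simp add: cmod_def power2_eq_square)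
  show "star_cmod U z \<otimes>\<^bsub>star_real U\<^esub> star_cmod U z =
      a \<otimes>\<^bsub>star_real U\<^esub> a \<oplus>\<^bsub>star_real U\<^esub> b \<otimes>\<^bsub>star_real U\<^esub> b"
    by (simp add: assms(3) fg ultrapower_simps star_map_family_class *)
  show "star_rel U (\<le>) \<zero>\<^bsub>star_real U\<^esub> (star_cmod U z)"
    by (simp add: assms(3) fg ultrapower_simps star_map_family_class star_rel_family_class)
qed

end

theory Submission
  imports Defs "HOL-Computational_Algebra.Fundamental_Theorem_Algebra"
begin

text \<open>
  A convex subring \<open>M\<close> is a valuation ring of \<open>star_complex U\<close>: if \<open>\<bar>z\<bar> \<le> 1\<close> fails then \<open>\<bar>1 / z\<bar> \<le> 1\<close>.
  Hence a root in \<open>star_complex U\<close> of a polynomial over \<open>M\<close> whose leading coefficient is a unit of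
  \<open>M\<close> lies in \<open>M\<close>, so roots descend to the residue field; roots upstairs are found pointwise, by the
  fundamental theorem of algebra and by the intermediate value theorem. For a maximal field \<open>K\<close> and
  \<open>z\<close> in \<open>M\<close>: if no nonzero \<open>p\<close> over \<open>K\<close> has \<open>p(z)\<close> in the maximal ideal, then \<open>K(z) \<subseteq> M\<close> and
  \<open>z \<in> K\<close>; otherwise such a \<open>p\<close> splits over \<open>K\<close>, again by maximality, and since the maximal ideal is
  prime, \<open>z\<close> is congruent to one of the roots.
\<close>

section \<open>Valuation rings\<close>

lemma (in field) inv_nonzero_closed: "\<lbrakk>x \<in> carrier R; x \<noteq> \<zero>\<rbrakk> \<Longrightarrow> inv x \<in> carrier R"
  by (simp add: field_Units)

lemma (in field) inv_nonzero_cancel: "\<lbrakk>x \<in> carrier R; x \<noteq> \<zero>\<rbrakk> \<Longrightarrow> inv x \<otimes> x = \<one>"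
  by (simp add: field_Units)

lemma (in field) inv_nonzero_mult:
  assumes "x \<in> carrier R" "y \<in> carrier R" "x \<noteq> \<zero>" "y \<noteq> \<zero>"
  shows "inv (x \<otimes> y) = inv x \<otimes> inv y"
proof (rule comm_inv_char)
  have "(x \<otimes> y) \<otimes> (inv x \<otimes> inv y) = (inv x \<otimes> x) \<otimes> (inv y \<otimes> y)"
    using assms inv_nonzero_closed by (simp add: m_ac)
  then show "(x \<otimes> y) \<otimes> (inv x \<otimes> inv y) = \<one>"
    using assms inv_nonzero_cancel by simp
qed (use assms inv_nonzero_closed in auto)

text \<open>The usual arithmetic of fractions, carried out inside the ambient field. With
  \<open>T\<close> the ring generated over a subfield by one element \<open>z\<close>, it provides
  the field to which maximality is applied when \<open>z\<close> is transcendental modulo the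
  nonunits.\<close>

lemma (in field) subfield_fractions:
  assumes "subring T R"
  shows "subfield {x \<otimes> inv y | x y. x \<in> T \<and> y \<in> T \<and> y \<noteq> \<zero>} R" (is "subfield ?L R")
proof -
  note T = subringE[OF assms]
  have c: "x \<in> carrier R" if "x \<in> T" for x using T(1) that by blast
  have I: "x \<otimes> inv y \<in> ?L" if "x \<in> T" "y \<in> T" "y \<noteq> \<zero>" for x y using that by blast
  have nz: "y \<otimes> v \<noteq> \<zero>" if "y \<in> T" "v \<in> T" "y \<noteq> \<zero>" "v \<noteq> \<zero>" for y v
    using that c integral by blast
  show ?thesis
  proof (rule subfieldI'[OF subringI])
    show "?L \<subseteq> carrier R" using c inv_nonzero_closed by auto
    have "\<one> = \<one> \<otimes> inv \<one>" by simp
    then show "\<one> \<in> ?L" using I[of \<one> \<one>] T(3) by auto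
  next
    fix h assume "h \<in> ?L"
    then obtain x y where h: "h = x \<otimes> inv y" "x \<in> T" "y \<in> T" "y \<noteq> \<zero>" by blast
    then have "\<ominus> h = (\<ominus> x) \<otimes> inv y" using c inv_nonzero_closed by (simp add: l_minus)
    then show "\<ominus> h \<in> ?L" using I[of "\<ominus> x" y] h T(5) by simp
  next
    fix h k assume "h \<in> ?L" "k \<in> ?L"
    then obtain x y u v where h: "h = x \<otimes> inv y" "x \<in> T" "y \<in> T" "y \<noteq> \<zero>"
      and k: "k = u \<otimes> inv v" "u \<in> T" "v \<in> T" "v \<noteq> \<zero>" by blast
    have cc: "x \<in> carrier R" "y \<in> carrier R" "u \<in> carrier R" "v \<in> carrier R"
      "inv y \<in> carrier R" "inv v \<in> carrier R"
      using h k c inv_nonzero_closed by auto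
    have i: "inv (y \<otimes> v) = inv y \<otimes> inv v" using cc h k by (simp add: inv_nonzero_mult)
    have "h \<otimes> k = (x \<otimes> u) \<otimes> inv (y \<otimes> v)" using cc h(1) k(1) i by (simp add: m_ac)
    then show "h \<otimes> k \<in> ?L" using I[of "x \<otimes> u" "y \<otimes> v"] h k T(6) nz by simp
    have "(x \<otimes> v \<oplus> u \<otimes> y) \<otimes> inv (y \<otimes> v)
        = (x \<otimes> inv y) \<otimes> (inv v \<otimes> v) \<oplus> (u \<otimes> inv v) \<otimes> (inv y \<otimes> y)"
      using cc i by (simp add: l_distr r_distr m_ac)
    also have "\<dots> = h \<oplus> k"
      using cc h k by (simp add: inv_nonzero_cancel)
    finally show "h \<oplus> k \<in> ?L"
      using I[of "x \<otimes> v \<oplus> u \<otimes> y" "y \<otimes> v"] h k T(6,7) nz by simp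
  next
    fix k assume k: "k \<in> ?L - {\<zero>}"
    then obtain x y where h: "k = x \<otimes> inv y" "x \<in> T" "y \<in> T" "y \<noteq> \<zero>" by blast
    then have x: "x \<noteq> \<zero>" using k c inv_nonzero_closed by auto
    have "inv k = y \<otimes> inv x"
    proof (rule comm_inv_char)
      have "k \<otimes> (y \<otimes> inv x) = (inv x \<otimes> x) \<otimes> (inv y \<otimes> y)"
        using h x c inv_nonzero_closed by (simp add: m_ac)
      then show "k \<otimes> (y \<otimes> inv x) = \<one>" using h x c inv_nonzero_cancel by simp
    qed (use h x c inv_nonzero_closed in auto)
    then show "inv k \<in> ?L" using I[of y x] h x by simp
  qed
qed

text \<open>Over an algebraically closed field the number of roots, counted with multiplicity, is
  the degree \<open>length as\<close>, which is positive here.\<close>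

lemma (in algebraically_closed) root_exists:
  assumes "set (a # as) \<subseteq> carrier L" "a \<noteq> \<zero>" "as \<noteq> []"
  shows "\<exists>r \<in> carrier L. eval (a # as) r = \<zero>"
proof -
  have p: "a # as \<in> carrier (poly_ring L)"
    using assms by (simp add: univ_poly_carrier[symmetric] polynomial_def)
  then have "size (roots (a # as)) \<noteq> 0"
    using roots_over_carrier[OF p] assms by (simp add: splitted_def)
  then obtain r where "r \<in># roots (a # as)" by fastforce
  then show ?thesis
    using roots_mem_iff_is_root[OF p] by (auto simp: is_root_def)
qed

section \<open>Valuation rings and their maximal ideals\<close>

locale valuation_subring = field S for S (structure) +
  fixes M :: "'a set"
  assumes subring_M: "subring M S"
    and valuation: "\<lbrakk>z \<in> carrier S; z \<notin> M\<rbrakk> \<Longrightarrow> inv z \<in> M"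
begin

text \<open>Zero has its own clause because \<open>inv \<zero>\<close> is an unspecified
  value.\<close>

definition nonunits :: "'a set"
  where "nonunits = {z \<in> M. z = \<zero> \<or> inv z \<notin> M}"

abbreviation residue_field :: "'a set ring"
  where "residue_field \<equiv> S\<lparr>carrier := M\<rparr> Quot nonunits"

abbreviation residue :: "'a \<Rightarrow> 'a set"
  where "residue z \<equiv> nonunits +>\<^bsub>S\<lparr>carrier := M\<rparr>\<^esub> z"

lemmas M_props = subringE[OF subring_M]

lemma M_carrier [simp]: "z \<in> M \<Longrightarrow> z \<in> carrier S"
  using M_props(1) by blast

lemma nonunits_subset: "nonunits \<subseteq> M"
  by (auto simp: nonunits_def)

lemma not_nonunit: "\<lbrakk>z \<in> M; z \<notin> nonunits\<rbrakk> \<Longrightarrow> z \<noteq> \<zero> \<and> inv z \<in> M"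
  by (auto simp: nonunits_def)

lemma one_not_nonunit: "\<one> \<notin> nonunits"
  using M_props(3) one_not_zero by (auto simp: nonunits_def)

lemma unit_notin_nonunits: "\<lbrakk>z \<in> M; w \<in> M; w \<otimes> z = \<one>\<rbrakk> \<Longrightarrow> z \<notin> nonunits"
  using comm_inv_char[of z w] m_comm[of z w] M_carrier by (auto simp: nonunits_def)

text \<open>If \<open>y \<otimes> x\<close> had an inverse \<open>w\<close> in \<open>M\<close>,
  then \<open>w \<otimes> y\<close> would be an inverse of \<open>x\<close> in
  \<open>M\<close>.\<close>

lemma nonunits_mult:
  assumes "x \<in> nonunits" "y \<in> M"
  shows "y \<otimes> x \<in> nonunits"
proof (rule ccontr)
  assume *: "y \<otimes> x \<notin> nonunits"
  have x: "x \<in> M" and yx: "y \<otimes> x \<in> M"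
    using assms M_props(6) nonunits_subset by auto
  define w where "w = inv (y \<otimes> x)"
  have w: "w \<in> M" "w \<otimes> (y \<otimes> x) = \<one>"
    using not_nonunit[OF yx *] inv_nonzero_cancel[of "y \<otimes> x"] yx by (auto simp: w_def)
  then have "(w \<otimes> y) \<otimes> x = \<one>" "w \<otimes> y \<in> M"
    using assms x M_props(6) by (auto simp: m_assoc)
  with unit_notin_nonunits[OF x] assms show False by blast
qed

text \<open>Here the valuation property makes \<open>M\<close> a local ring: of the two quotients of
  nonzero \<open>x\<close> and \<open>y\<close> one lies in \<open>M\<close>, so the sum is a
  multiple, with factor in \<open>M\<close>, of one of the summands.\<close>

lemma nonunits_add:
  assumes "x \<in> nonunits" "y \<in> nonunits"
  shows "x \<oplus> y \<in> nonunits"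
proof -
  have *: "x \<oplus> t \<otimes> x \<in> nonunits" if "x \<in> nonunits" "t \<in> M" for x t
  proof -
    have "x \<in> carrier S" using that nonunits_subset by auto
    then have "x \<oplus> t \<otimes> x = (\<one> \<oplus> t) \<otimes> x"
      using that by (simp add: l_distr)
    then show ?thesis
      using nonunits_mult[OF that(1)] that M_props(3,7) by auto
  qed
  have c: "x \<in> carrier S" "y \<in> carrier S"
    using assms nonunits_subset by auto
  show ?thesis
  proof (cases "y = \<zero>")
    case False
    define w where "w = x \<otimes> inv y"
    have w: "w \<in> carrier S" "w \<otimes> y = x"
      using c False by (simp_all add: w_def m_assoc inv_nonzero_closed inv_nonzero_cancel)
    show ?thesis
    proof (cases "w \<in> M")
      case True
      then show ?thesis using *[OF assms(2) True] w c by (simp add: a_comm)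
    next
      case w': False
      then have "w \<noteq> \<zero>" using M_props(2) by auto
      then have "inv w \<otimes> x = y"
        using w c inv_nonzero_closed inv_nonzero_cancel by (metis l_one m_assoc)
      then show ?thesis using *[OF assms(1) valuation[OF w(1) w']] by simp
    qed
  qed (use assms c in auto)
qed

lemma domain_M: "domain (S\<lparr>carrier := M\<rparr>)"
  using subring_is_domain[OF subring_M] .

lemma ideal_nonunits: "ideal nonunits (S\<lparr>carrier := M\<rparr>)"
proof -
  interpret D: domain "S\<lparr>carrier := M\<rparr>" by (rule domain_M)
  have neg: "\<ominus> x \<in> nonunits" if "x \<in> nonunits" for x
  proof -
    have "\<ominus> x = (\<ominus> \<one>) \<otimes> x" "\<ominus> \<one> \<in> M"
      using that nonunits_subset M_props(3,5) by (auto simp: l_minus)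
    then show ?thesis using nonunits_mult[OF that] by simp
  qed
  have "subgroup nonunits (add_monoid (S\<lparr>carrier := M\<rparr>))"
  proof (rule group.subgroupI[OF D.add.is_group])
    fix x assume x: "x \<in> nonunits"
    have "\<ominus>\<^bsub>S\<lparr>carrier := M\<rparr>\<^esub> x \<in> nonunits"
    proof -
      have "\<ominus>\<^bsub>S\<lparr>carrier := M\<rparr>\<^esub> x = \<ominus> x"
        using x nonunits_subset M_props(5)
        by (intro D.minus_equality) (auto simp: l_neg)
      then show ?thesis using neg[OF x] by simp
    qed
    then show "inv\<^bsub>add_monoid (S\<lparr>carrier := M\<rparr>)\<^esub> x \<in> nonunits"
      by (simp add: a_inv_def)
  qed (use nonunits_subset nonunits_add M_props(2) in \<open>auto simp: nonunits_def\<close>)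
  then show ?thesis
    using nonunits_mult nonunits_subset
    by (intro idealI[OF D.ring_axioms]) (auto, metis M_carrier m_comm subsetD)
qed

text \<open>A strictly larger ideal contains a unit of \<open>M\<close>, hence
  \<open>\<one>\<close>.\<close>

lemma maximalideal_nonunits: "maximalideal nonunits (S\<lparr>carrier := M\<rparr>)"
proof (rule maximalidealI[OF ideal_nonunits])
  show "carrier (S\<lparr>carrier := M\<rparr>) \<noteq> nonunits"
    using M_props(3) one_not_nonunit by auto
  fix I assume I: "ideal I (S\<lparr>carrier := M\<rparr>)" "nonunits \<subseteq> I" "I \<subseteq> carrier (S\<lparr>carrier := M\<rparr>)"
  show "I = nonunits \<or> I = carrier (S\<lparr>carrier := M\<rparr>)"
  proof (cases "I = nonunits")
    case False
    then obtain z where z: "z \<in> I" "z \<notin> nonunits" using I by blast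
    then have "z \<in> M" using I by auto
    with z have "inv z \<otimes> z = \<one>" "inv z \<in> M"
      using not_nonunit[of z] inv_nonzero_cancel by auto
    then have "\<one> \<in> I"
      using ideal.I_l_closed[OF I(1) z(1), of "inv z"] by auto
    then show ?thesis
      using ideal.one_imp_carrier[OF I(1)] by simp
  qed simp
qed

section \<open>The residue field and the descent of roots\<close>

lemma field_residue_field: "field residue_field"
  using maximalideal.quotient_is_field[OF maximalideal_nonunits] domain_M
  by (simp add: domain_def)

lemma residue_hom: "ring_hom_ring (S\<lparr>carrier := M\<rparr>) residue_field residue"
  using ideal.rcos_ring_hom_ring[OF ideal_nonunits] .

lemma carrier_residue_field: "carrier residue_field = residue ` M"
  by (auto simp: FactRing_def A_RCOSETS_def RCOSETS_def a_r_coset_def)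

lemma residue_eq_zero_iff: "z \<in> M \<Longrightarrow> residue z = \<zero>\<^bsub>residue_field\<^esub> \<longleftrightarrow> z \<in> nonunits"
proof -
  assume z: "z \<in> M"
  interpret I: ideal nonunits "S\<lparr>carrier := M\<rparr>" by (rule ideal_nonunits)
  show ?thesis
    using z I.a_rcos_const[of z] I.a_rcos_self[of z] by (auto simp: FactRing_def)
qed

lemma residue_eq_iff:
  assumes "z \<in> M" "w \<in> M"
  shows "residue z = residue w \<longleftrightarrow> z \<ominus> w \<in> nonunits"
proof -
  interpret F: field residue_field by (rule field_residue_field)
  interpret h: ring_hom_ring "S\<lparr>carrier := M\<rparr>" residue_field residue by (rule residue_hom)
  have m: "z \<ominus> w \<in> M" "z = (z \<ominus> w) \<oplus> w"
    using assms M_props(5,7) by (auto simp: minus_eq a_assoc l_neg)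
  have "residue z = residue (z \<ominus> w) \<oplus>\<^bsub>residue_field\<^esub> residue w"
    using h.hom_add[of "z \<ominus> w" w] m assms by simp
  moreover have "residue (z \<ominus> w) \<in> carrier residue_field" "residue w \<in> carrier residue_field"
    using m assms by (auto simp: carrier_residue_field)
  ultimately have "residue z = residue w \<longleftrightarrow> residue (z \<ominus> w) = \<zero>\<^bsub>residue_field\<^esub>"
    by (metis F.add.right_cancel F.l_zero F.zero_closed)
  then show ?thesis using residue_eq_zero_iff m by simp
qed

text \<open>If a root \<open>r\<close> were outside \<open>M\<close>, then \<open>inv r\<close> would be a nonunit, and multiplying the equation
  by a power of \<open>inv r\<close> would exhibit the leading coefficient as a nonunit.\<close>

lemma root_in_M:
  assumes as: "set (a # as) \<subseteq> M" "a \<notin> nonunits" and r: "r \<in> carrier S" "eval (a # as) r = \<zero>"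
  shows "r \<in> M"
proof (rule ccontr)
  assume "r \<notin> M"
  then have r0: "r \<noteq> \<zero>" using M_props(2) by auto
  define s where "s = inv r"
  have s: "s \<in> M" "r \<otimes> s = \<one>" "s \<in> carrier S"
    using valuation[OF r(1) \<open>r \<notin> M\<close>] r r0 by (auto simp: s_def field_Units)
  have "inv s = r" using s r by (intro comm_inv_char) (auto simp: m_comm)
  then have sJ: "s \<in> nonunits" using s \<open>r \<notin> M\<close> by (simp add: nonunits_def)
  have pow: "r [^] n \<otimes> s [^] n = \<one>" for n :: nat
    using s r by (metis nat_pow_distrib nat_pow_one)
  \<comment> \<open>The exponent \<open>length bs\<close> exceeds the degree by one, so every term,
    the leading one included, keeps a factor \<open>s\<close>. The claim is applied to the tail
    \<open>as\<close>, where \<open>length as\<close> is exactly the exponent that cancels the power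
    of \<open>r\<close> at the leading coefficient \<open>a\<close>.\<close>
  have *: "eval bs r \<otimes> s [^] length bs \<in> nonunits" if "set bs \<subseteq> M" for bs
    using that
  proof (induction bs)
    case Nil
    then show ?case using M_props(2) by (simp add: nonunits_def)
  next
    case (Cons b bs)
    have c: "b \<in> carrier S" "eval bs r \<in> carrier S" "set bs \<subseteq> carrier S"
      using Cons.prems r M_props(1) eval_in_carrier[of bs r] by auto
    have "eval (b # bs) r \<otimes> s [^] length (b # bs)
        = (b \<otimes> r [^] length bs \<oplus> eval bs r) \<otimes> (s [^] length bs \<otimes> s)" by simp
    also have "\<dots> = b \<otimes> (r [^] length bs \<otimes> s [^] length bs) \<otimes> s
        \<oplus> s \<otimes> (eval bs r \<otimes> s [^] length bs)"
      using c s r by (simp add: l_distr r_distr m_ac)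
    also have "\<dots> = b \<otimes> s \<oplus> s \<otimes> (eval bs r \<otimes> s [^] length bs)"
      using c by (simp add: pow)
    finally show ?case
      using Cons nonunits_mult[OF sJ] nonunits_mult nonunits_add s by auto
  qed
  have c: "a \<in> carrier S" "set as \<subseteq> carrier S" "eval as r \<in> carrier S"
    using as r eval_in_carrier[of as r] M_props(1) by auto
  have "\<zero> = eval (a # as) r \<otimes> s [^] length as" using r(2) s by (simp del: eval.simps)
  also have "\<dots> = a \<oplus> eval as r \<otimes> s [^] length as"
    using c s r(1) by (simp add: l_distr m_assoc pow)
  finally have "a = (\<ominus> \<one>) \<otimes> (eval as r \<otimes> s [^] length as)"
    using c s by (metis add.inv_equality l_minus l_one m_closed minus_minus nat_pow_closed one_closed r(1) add.inv_closed a_comm)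
  then have "a \<in> nonunits"
    using nonunits_mult[OF *[of as]] as M_props(3,5) by auto
  with as show False by blast
qed

text \<open>By \<open>root_in_M\<close> the root has a residue, and \<open>residue\<close> is a
  homomorphism on \<open>M\<close>; evaluation over \<open>M\<close> agrees with evaluation over
  \<open>S\<close>.\<close>

lemma residue_root:
  assumes as: "set (a # as) \<subseteq> M" "a \<notin> nonunits" and r: "r \<in> carrier S" "eval (a # as) r = \<zero>"
  shows "ring.eval residue_field (map residue (a # as)) (residue r) = \<zero>\<^bsub>residue_field\<^esub>"
proof -
  interpret h: ring_hom_ring "S\<lparr>carrier := M\<rparr>" residue_field residue by (rule residue_hom)
  have "r \<in> M" using root_in_M[OF assms] .
  then show ?thesis
    using h.eval_hom'[of r "a # as"] as r h.hom_zero
    by (simp only: eval_consistent[OF subring_M]) simp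
qed

text \<open>If \<open>x\<close> is a unit of \<open>M\<close>, multiplying the product by
  \<open>inv x\<close> makes \<open>y\<close> a nonunit.\<close>

lemma nonunits_prime:
  assumes "x \<in> M" "y \<in> M" "x \<otimes> y \<in> nonunits"
  shows "x \<in> nonunits \<or> y \<in> nonunits"
proof (rule ccontr)
  assume *: "\<not> ?thesis"
  then have x: "x \<noteq> \<zero>" "inv x \<in> M" using not_nonunit assms by auto
  then have "y = inv x \<otimes> (x \<otimes> y)"
    using assms inv_nonzero_cancel[of x] by (metis M_carrier l_one m_assoc)
  then show False using nonunits_mult[OF assms(3) x(2)] * by simp
qed

text \<open>The leading coefficient has nonzero residue and so lifts to a unit of \<open>M\<close>,
  as \<open>root_in_M\<close> requires. The set \<open>N\<close> is a parameter because coefficients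
  will be lifted both to \<open>M\<close> and to the real elements of \<open>M\<close>.\<close>

lemma lift_polynomial:
  assumes "set p \<subseteq> residue ` N" "N \<subseteq> M" "p \<noteq> []" "hd p \<noteq> \<zero>\<^bsub>residue_field\<^esub>"
  shows "\<exists>a as. set (a # as) \<subseteq> N \<and> a \<notin> nonunits \<and> p = map residue (a # as)"
proof -
  have "p \<in> map residue ` lists N" using assms(1) by (metis in_listsI lists_image subsetD)
  then obtain as where as: "set as \<subseteq> N" "p = map residue as" by auto
  then obtain b bs where b: "as = b # bs" using assms(3) by (cases as) auto
  have "b \<notin> nonunits" using assms as b residue_eq_zero_iff[of b] by auto
  then show ?thesis using as b by blast
qed

lemma algebraically_closed_residue_field:
  assumes "algebraically_closed S"
  shows "algebraically_closed residue_field"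
proof -
  interpret F: field residue_field by (rule field_residue_field)
  interpret S: algebraically_closed S by (rule assms)
  show ?thesis
  proof (rule F.algebraically_closedI)
    \<comment> \<open>The degree is \<open>length p - 1\<close>. The criterion asks for roots in
      degree above 1 only, linear polynomials having roots in every field.\<close>
    fix p assume p: "p \<in> carrier (poly_ring residue_field)" "length p - 1 > 1"
    then have "polynomial\<^bsub>residue_field\<^esub> (carrier residue_field) p" "p \<noteq> []"
      by (auto simp: univ_poly_carrier)
    then obtain a as where as: "set (a # as) \<subseteq> M" "a \<notin> nonunits" "p = map residue (a # as)"
      using lift_polynomial[of p M] by (auto simp: polynomial_def carrier_residue_field)
    moreover have "a \<noteq> \<zero>" "as \<noteq> []" using as not_nonunit p(2) by auto
    ultimately obtain r where r: "r \<in> carrier S" "eval (a # as) r = \<zero>"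
      using S.root_exists[of a as] M_props(1) by blast
    show "\<exists>x\<in>carrier residue_field. F.eval p x = \<zero>\<^bsub>residue_field\<^esub>"
      using residue_root[OF as(1,2) r] root_in_M[OF as(1,2) r] as(3)
      by (auto simp: carrier_residue_field simp del: F.eval.simps)
  qed
qed

section \<open>Maximal subfields of a valuation ring\<close>

context
  fixes K
  assumes closed: "algebraically_closed S"
    and K: "subfield K S" "K \<subseteq> M"
    and maximal: "\<And>L. \<lbrakk>subfield L S; K \<subseteq> L; L \<subseteq> M\<rbrakk> \<Longrightarrow> L = K"
begin

lemmas K_props = subringE[OF subfieldE(1)[OF K(1)]]

text \<open>A nonzero element of \<open>K\<close> has its inverse in \<open>K\<close>, hence in
  \<open>M\<close>. This gives injectivity of \<open>residue\<close> on \<open>K\<close> and makes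
  nonzero leading coefficients over \<open>K\<close> units of \<open>M\<close>.\<close>

lemma subfield_nonunits: "x \<in> K \<Longrightarrow> x \<in> nonunits \<Longrightarrow> x = \<zero>"
  using subfield_m_inv(1)[OF K(1), of x] K(2) by (auto simp: nonunits_def)

text \<open>The root lies in \<open>M\<close> by \<open>root_in_M\<close>, and being algebraic it
  generates a field over \<open>K\<close> inside \<open>M\<close>, which maximality collapses to
  \<open>K\<close>. Thus \<open>K\<close> is algebraically closed in \<open>S\<close>.\<close>

lemma maximal_subfield_root:
  assumes "p \<in> carrier (K[X])" "p \<noteq> []" "r \<in> carrier S" "eval p r = \<zero>"
  shows "r \<in> K"
proof -
  obtain a as where p: "p = a # as" using assms(2) by (cases p) auto
  have as: "set (a # as) \<subseteq> K" "a \<noteq> \<zero>"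
    using assms(1) p by (auto simp: univ_poly_carrier[symmetric] polynomial_def)
  then have r: "r \<in> M"
    using root_in_M[of a as r] subfield_nonunits[of a] assms p K(2) by auto
  have "(algebraic over K) r"
    using algebraicI[OF assms(1,2,4)] by (simp add: over_def)
  then have "subfield (simple_extension K r) S"
    using simple_extension_is_subfield[OF K(1) assms(3)] by simp
  moreover have "K \<subseteq> simple_extension K r"
    using simple_extension_incl[OF K_props(1) assms(3)] .
  moreover have "simple_extension K r \<subseteq> M"
    using simple_extension_subring_incl[OF subring_M K(2) r] .
  ultimately have "simple_extension K r = K" by (rule maximal)
  then show ?thesis
    using simple_extension_mem[OF subfieldE(1)[OF K(1)] assms(3)] by simp
qed

lemma eval_in_M:
  assumes "p \<in> carrier (K[X])" "z \<in> M" shows "eval p z \<in> M"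
proof -
  have "set p \<subseteq> M" using assms K(2) by (auto simp: univ_poly_carrier[symmetric] polynomial_def)
  then show ?thesis
    using ring.eval_in_carrier[OF subring_is_ring[OF subring_M], of p z] assms
    by (simp add: eval_consistent[OF subring_M])
qed

text \<open>Division by the linear polynomial takes place over \<open>K\<close>, and evaluation at a
  point of \<open>S\<close>, a homomorphism on \<open>K[X]\<close>, turns the factorization into an
  identity of values. The bound on \<open>length q\<close> drives the induction in
  \<open>algebraic_residue\<close>.\<close>

lemma factor_root:
  assumes p: "p \<in> carrier (K[X])" "p \<noteq> []" and r: "r \<in> K" "eval p r = \<zero>"
  obtains q where "q \<in> carrier (K[X])" "q \<noteq> []" "length q < length p"
    "\<And>z. z \<in> carrier S \<Longrightarrow> eval p z = (z \<ominus> r) \<otimes> eval q z"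
proof -
  note sub = subfieldE(1)[OF K(1)]
  interpret D: domain "S\<lparr>carrier := K\<rparr>" by (rule subring_is_domain[OF sub])
  interpret KX: domain "K[X]" by (rule univ_poly_is_domain[OF sub])
  have neg: "\<ominus>\<^bsub>S\<lparr>carrier := K\<rparr>\<^esub> r = \<ominus> r"
    using r K_props by (intro D.minus_equality) (auto simp: l_neg)
  have b: "[\<one>, \<ominus> r] \<in> carrier (K[X])"
    using r K_props by (auto simp: univ_poly_carrier[symmetric] polynomial_def)
  have "D.is_root p r"
    using p r by (simp add: D.is_root_def eval_consistent[OF sub])
  then have "[\<one>, \<ominus> r] pdivides\<^bsub>S\<lparr>carrier := K\<rparr>\<^esub> p"
    using D.is_root_imp_pdivides[of p r] p neg by (simp add: univ_poly_consistent[OF sub])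
  then obtain q where q: "q \<in> carrier (K[X])" "p = [\<one>, \<ominus> r] \<otimes>\<^bsub>K[X]\<^esub> q"
    by (auto simp: pdivides_def factor_def univ_poly_consistent[OF sub])
  have q0: "q \<noteq> []"
    using q p(2) b KX.r_null by (metis univ_poly_zero)
  have len: "length p - 1 = 1 + (length q - 1)"
    using poly_mult_degree_eq[OF sub, of "[\<one>, \<ominus> r]" q] q b q0
    by (simp add: univ_poly_mult univ_poly_carrier)
  have ev: "eval p z = (z \<ominus> r) \<otimes> eval q z" if z: "z \<in> carrier S" for z
  proof -
    interpret e: ring_hom_ring "K[X]" S "\<lambda>p. eval p z" by (rule eval_ring_hom[OF sub z])
    show ?thesis
      using e.hom_mult[OF b q(1)] q(2) z r K_props(1) by (auto simp: minus_eq)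
  qed
  show ?thesis
    using that[OF q(1) q0 _ ev] len q0 by (cases p; cases q) auto
qed

text \<open>Some root \<open>r\<close> of \<open>p\<close> lies in \<open>K\<close>. Since the
  nonunits are prime, either \<open>z \<ominus> r\<close> is a nonunit or the shorter cofactor takes
  a nonunit value at \<open>z\<close>, and the induction continues with it.\<close>

lemma algebraic_residue:
  assumes "z \<in> M" "p \<in> carrier (K[X])" "p \<noteq> []" "eval p z \<in> nonunits"
  shows "\<exists>a \<in> K. z \<ominus> a \<in> nonunits"
  using assms(2-)
proof (induction "length p" arbitrary: p rule: less_induct)
  case less
  obtain a as where p: "p = a # as" using less(3) by (cases p) auto
  have as: "set (a # as) \<subseteq> K" "a \<noteq> \<zero>"
    using less(2) p by (auto simp: univ_poly_carrier[symmetric] polynomial_def)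
  \<comment> \<open>Otherwise \<open>eval p z\<close> would be the constant \<open>a\<close>, a
    nonzero element of \<open>K\<close> among the nonunits.\<close>
  have "as \<noteq> []"
    using less(4) as p subfield_nonunits[of a] K_props(1) assms(1) by auto
  then obtain r where r: "r \<in> carrier S" "eval p r = \<zero>"
    using algebraically_closed.root_exists[OF closed, of a as] as K_props(1) p by blast
  have rK: "r \<in> K" using maximal_subfield_root[OF less(2,3) r] .
  obtain q where q: "q \<in> carrier (K[X])" "q \<noteq> []" "length q < length p"
    "eval p z = (z \<ominus> r) \<otimes> eval q z"
    using factor_root[OF less(2,3) rK r(2)] assms(1) M_carrier by metis
  have "z \<ominus> r \<in> M"
    using assms(1) rK K(2) M_props(5,7) by (auto simp: minus_eq)
  then have "z \<ominus> r \<in> nonunits \<or> eval q z \<in> nonunits"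
    using nonunits_prime[of "z \<ominus> r" "eval q z"] eval_in_M[OF q(1) assms(1)] less(4) q(4) by simp
  then show ?case using less(1)[OF q(3,1,2)] rK by blast
qed

text \<open>If \<open>z\<close> is transcendental modulo the nonunits, the field of fractions of \<open>K[z]\<close> stays inside
  \<open>M\<close>, so maximality forces \<open>z\<close> into \<open>K\<close>.\<close>

lemma maximal_subfield_residue:
  assumes "z \<in> M"
  shows "\<exists>a \<in> K. z \<ominus> a \<in> nonunits"
proof (cases "\<exists>p \<in> carrier (K[X]). p \<noteq> [] \<and> eval p z \<in> nonunits")
  case True
  then show ?thesis using algebraic_residue[OF assms] by blast
next
  case False
  note sub = subfieldE(1)[OF K(1)]
  have z: "z \<in> carrier S" using assms by simp
  let ?T = "simple_extension K z"
  let ?L = "{x \<otimes> inv y | x y. x \<in> ?T \<and> y \<in> ?T \<and> y \<noteq> \<zero>}"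
  have T: "subring ?T S" using simple_extension_is_subring[OF sub z] .
  have TM: "?T \<subseteq> M" using simple_extension_subring_incl[OF subring_M K(2) assms] .
  \<comment> \<open>Here \<open>y\<close> is \<open>eval p z\<close> for some \<open>p\<close> over
    \<open>K\<close>, and \<open>p \<noteq> []\<close> because \<open>eval [] z\<close> is
    zero.\<close>
  have unit: "y \<notin> nonunits" if "y \<in> ?T" "y \<noteq> \<zero>" for y
    using that False simple_extension_as_eval_img[OF K_props(1) z] by auto
  have TL: "?T \<subseteq> ?L"
  proof
    fix x assume x: "x \<in> ?T"
    then have "x = x \<otimes> inv \<one>" using TM by auto
    then show "x \<in> ?L" using x subringE(3)[OF T] one_not_zero by blast
  qed
  have "?L = K"
  proof (rule maximal[OF subfield_fractions[OF T]])
    show "K \<subseteq> ?L" using simple_extension_incl[OF K_props(1) z] TL by blast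
    show "?L \<subseteq> M" using TM unit not_nonunit M_props(6) by blast
  qed
  then have "z \<in> K" using TL simple_extension_mem[OF sub z] by blast
  moreover have "z \<ominus> z \<in> nonunits" using z M_props(2) by (simp add: nonunits_def minus_eq r_neg)
  ultimately show ?thesis by blast
qed

text \<open>Injectivity holds because \<open>K\<close> meets the nonunits in zero only; surjectivity
  is \<open>maximal_subfield_residue\<close>.\<close>

theorem maximal_subfield_iso: "residue \<in> ring_iso (S\<lparr>carrier := K\<rparr>) residue_field"
proof -
  interpret h: ring_hom_ring "S\<lparr>carrier := M\<rparr>" residue_field residue by (rule residue_hom)
  have "residue \<in> ring_hom (S\<lparr>carrier := K\<rparr>) residue_field"
    using h.hom_mult h.hom_add h.hom_one h.hom_closed K(2) by (intro ring_hom_memI) (simp_all add: subset_iff)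
  moreover have "inj_on residue K"
  proof (rule inj_onI)
    fix x y assume xy: "x \<in> K" "y \<in> K" "residue x = residue y"
    then have "x \<ominus> y \<in> nonunits" "x \<ominus> y \<in> K"
      using residue_eq_iff[of x y] K(2) K_props(5,7) by (auto simp: minus_eq)
    then have "x \<ominus> y = \<zero>" using subfield_nonunits by blast
    then show "x = y" using xy K_props(1) by (simp add: subset_iff)
  qed
  moreover have "residue ` K = carrier residue_field"
  proof -
    have "residue z \<in> residue ` K" if "z \<in> M" for z
      using maximal_subfield_residue[OF that] residue_eq_iff[of z] that K(2) by blast
    then show ?thesis using K(2) by (auto simp: carrier_residue_field)
  qed
  ultimately show ?thesis
    by (simp add: ring_iso_def bij_betw_def)
qed

end

end

section \<open>Ultrapowers\<close>

lemma eventually_not_ultrafilter: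
  assumes "is_ultrafilter U" "\<not> (\<forall>\<^sub>F i in U. P i)"
  shows "\<forall>\<^sub>F i in U. \<not> P i"
  using assms(1)[unfolded is_ultrafilter_def, THEN conjunct2, rule_format, of "{i. P i}"] assms(2)
  by simp

text \<open>Polynomials of \<open>poly_ring\<close> list the leading coefficient first,
  \<open>Poly\<close> the constant term first; hence \<open>rev\<close>. The right-hand side has the
  shape of the recursion of \<open>eval\<close>.\<close>

lemma poly_Poly_rev_Cons:
  "poly (Poly (rev (a # as))) (x :: 'a::comm_ring_1) = a * x ^ length as + poly (Poly (rev as)) x"
  by (simp add: Poly_snoc poly_monom)

lemma degree_Poly_rev_Cons: "a \<noteq> 0 \<Longrightarrow> Polynomial.degree (Poly (rev (a # as))) = length as"
  by (simp add: degree_eq_length_coeffs strip_while_def)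

text \<open>By the intermediate value theorem. For a positive leading coefficient, \<open>p\<close>
  is positive far to the right; the polynomial \<open>- p (- x)\<close> has the same leading
  coefficient because the degree is odd, so \<open>p\<close> is negative far to the left. The other
  sign is reduced to this one by negation.\<close>

lemma real_odd_degree_root:
  fixes p :: "real poly"
  assumes "odd (Polynomial.degree p)"
  shows "\<exists>x. poly p x = 0"
proof -
  have *: "\<exists>x. poly p x = 0" 
    if p: "odd (Polynomial.degree p)" "0 < Polynomial.lead_coeff p" for p :: "real poly"
  proof -
    define q where "q = - pcompose p [:0, -1:]"
    have "Polynomial.lead_coeff (pcompose p [:0, -1:]) = - Polynomial.lead_coeff p"
      using p(1) by (subst lead_coeff_comp) auto
    then have "Polynomial.lead_coeff q = Polynomial.lead_coeff p"
      unfolding q_def lead_coeff_minus by simp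
    then obtain m n where m: "\<And>x. x \<ge> m \<Longrightarrow> poly q x \<ge> Polynomial.lead_coeff q"
      and n: "\<And>x. x \<ge> n \<Longrightarrow> poly p x \<ge> Polynomial.lead_coeff p" and lc: "Polynomial.lead_coeff q > 0"
      using poly_pinfty_gt_lc[of q] poly_pinfty_gt_lc[of p] p(2) by metis
    \<comment> \<open>The \<open>max 1\<close> puts the two points on opposite sides of zero, so
      that the interval is proper.\<close>
    have "poly q (max 1 m) > 0" using m[of "max 1 m"] lc by linarith
    then have "poly p (- max 1 m) < 0"
      by (simp add: q_def poly_pcompose)
    moreover have "poly p (max 1 n) > 0"
      using n[of "max 1 n"] p(2) by linarith
    moreover have "- max 1 m < max 1 n" by linarith
    ultimately show ?thesis using poly_IVT_pos by blast
  qed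
  have "p \<noteq> 0" using assms by auto
  then have "Polynomial.lead_coeff p \<noteq> 0" by simp
  then have "0 < Polynomial.lead_coeff p \<or> 0 < Polynomial.lead_coeff (- p)"
    unfolding lead_coeff_minus by linarith
  then show ?thesis
    using *[of p] *[of "- p"] assms by auto
qed

section \<open>Pointwise arithmetic and roots in ultrapowers\<close>

context
  fixes U :: "'i filter"
  assumes U: "is_ultrafilter U"
begin

lemma ultrapower_pow:
  "family_class U (f :: 'i \<Rightarrow> 'a::field) [^]\<^bsub>ultrapower U\<^esub> (n :: nat) = family_class U (\<lambda>i. f i ^ n)"
proof -
  interpret field "ultrapower U :: ('i \<Rightarrow> 'a) set ring" by (rule field_ultrapower[OF U])
  show ?thesis
    by (induction n) (simp_all add: ultrapower_simps mult.commute)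
qed

text \<open>The theorem of Los for values of polynomials: coefficients and argument are evaluated
  index by index.\<close>

lemma ultrapower_eval:
  "ring.eval (ultrapower U) (map (family_class U) fs) (family_class U g) =
    family_class U (\<lambda>i. poly (Poly (rev (map (\<lambda>f. f i) fs))) (g i :: 'a::field))"
proof -
  interpret field "ultrapower U :: ('i \<Rightarrow> 'a) set ring" by (rule field_ultrapower[OF U])
  show ?thesis
  proof (induction fs)
    case (Cons f fs)
    then show ?case
      by (simp add: ultrapower_pow ultrapower_simps poly_Poly_rev_Cons del: rev.simps)
  qed (simp add: ultrapower_simps)
qed

text \<open>The leading coefficient is nonzero at almost every index, so the polynomials there have
  the right degree and a root can be chosen at each. The assumption on one degree covers both
  positive degrees over the complex numbers and odd degrees over the reals.\<close>

lemma ultrapower_root: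
  fixes a :: "('i \<Rightarrow> 'a::field) set"
  assumes roots: "\<And>p :: 'a poly. Polynomial.degree p = length as \<Longrightarrow> \<exists>x. poly p x = 0"
    and as: "set (a # as) \<subseteq> carrier (ultrapower U)" "a \<noteq> \<zero>\<^bsub>ultrapower U\<^esub>"
  shows "\<exists>r \<in> carrier (ultrapower U). ring.eval (ultrapower U) (a # as) r = \<zero>\<^bsub>ultrapower U\<^esub>"
proof -
  have "a # as \<in> map (family_class U) ` lists UNIV"
    using as(1) by (metis in_listsI lists_image subsetD ultrapower_simps(1))
  then obtain f fs where fs: "a # as = map (family_class U) (f # fs)" by force
  define P where "P i = Poly (rev (map (\<lambda>g. g i) (f # fs)))" for i
  \<comment> \<open>Where \<open>f i\<close> vanishes the choice may be no root; the ultrafilter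
    contains the complement of these indices.\<close>
  define g where "g i = (SOME x. poly (P i) x = 0)" for i
  have "\<forall>\<^sub>F i in U. f i \<noteq> 0"
    using eventually_not_ultrafilter[OF U, of "\<lambda>i. f i = 0"] as(2) fs
    by (simp add: ultrapower_simps family_class_eq_iff)
  then have "\<forall>\<^sub>F i in U. poly (P i) (g i) = 0"
  proof eventually_elim
    case (elim i)
    have "Polynomial.degree (P i) = length as"
      using degree_Poly_rev_Cons[of "f i" "map (\<lambda>g. g i) fs"] elim fs by (simp add: P_def)
    then show ?case unfolding g_def using someI_ex[OF roots] by blast
  qed
  then have "ring.eval (ultrapower U) (a # as) (family_class U g) = \<zero>\<^bsub>ultrapower U\<^esub>"
    unfolding fs ultrapower_eval by (simp add: P_def ultrapower_simps family_class_eq_iff)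
  then show ?thesis by (auto simp: ultrapower_simps)
qed

lemma algebraically_closed_star_complex: "algebraically_closed (star_complex U)"
proof -
  interpret field "star_complex U" by (rule field_ultrapower[OF U])
  show ?thesis
  proof (rule algebraically_closedI)
    fix p assume p: "p \<in> carrier (poly_ring (star_complex U))" "length p - 1 > 1"
    then obtain a as where a: "p = a # as" by (cases p) auto
    show "\<exists>x\<in>carrier (star_complex U). eval p x = \<zero>\<^bsub>star_complex U\<^esub>"
      unfolding a
    proof (rule ultrapower_root)
      fix q :: "complex poly" assume "Polynomial.degree q = length as"
      then show "\<exists>x. poly q x = 0"
        using p(2) a fundamental_theorem_of_algebra[of q] by (cases "as = []") (auto simp: constant_degree)
    qed (use p(1) a in \<open>auto simp: univ_poly_carrier[symmetric] polynomial_def\<close>)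
  qed
qed

lemma star_complex_of_real_hom:
  "ring_hom_ring (star_real U) (star_complex U) (star_complex_of_real U)"
proof -
  interpret R: field "star_real U" by (rule field_ultrapower[OF U])
  interpret C: field "star_complex U" by (rule field_ultrapower[OF U])
  show ?thesis
    by (intro ring_hom_ringI R.ring_axioms C.ring_axioms)
      (auto simp: ultrapower_simps star_map_family_class)
qed

lemma ultrapower_inv:
  assumes "\<forall>\<^sub>F i in U. f i \<noteq> (0 :: 'a::field)"
  shows "inv\<^bsub>ultrapower U\<^esub> (family_class U f) = family_class U (\<lambda>i. inverse (f i))"
proof -
  interpret field "ultrapower U :: ('i \<Rightarrow> 'a) set ring" by (rule field_ultrapower[OF U])
  show ?thesis
    using assms
    by (intro comm_inv_char)
      (auto simp: ultrapower_simps family_class_eq_iff elim!: eventually_mono)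
qed

lemma ultrapower_nonzero:
  "family_class U f \<noteq> \<zero>\<^bsub>ultrapower U\<^esub> \<longleftrightarrow> (\<forall>\<^sub>F i in U. f i \<noteq> (0 :: 'a::field))"
proof -
  have "\<not> ((\<forall>\<^sub>F i in U. f i \<noteq> 0) \<and> (\<forall>\<^sub>F i in U. f i = 0))"
    using U by (auto simp: is_ultrafilter_def eventually_False dest: eventually_conj)
  then show ?thesis
    using eventually_not_ultrafilter[OF U, of "\<lambda>i. f i = 0"]
    by (auto simp: ultrapower_simps family_class_eq_iff)
qed

section \<open>Convex subrings as valuation rings\<close>

context
  fixes M :: "('i \<Rightarrow> complex) set set"
  assumes M: "convex_subring U M"
begin

lemma convex_subringD:
  assumes "family_class U g \<in> M" "\<forall>\<^sub>F i in U. cmod (f i) \<le> cmod (g i)"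
  shows "family_class U f \<in> M"
proof -
  have "star_rel U (\<le>) (star_cmod U (family_class U f)) (star_cmod U (family_class U g))"
    using assms(2) by (simp add: star_map_family_class star_rel_family_class)
  moreover have "family_class U f \<in> carrier (star_complex U)"
    by (simp add: ultrapower_simps)
  ultimately show ?thesis
    using M assms(1) unfolding convex_subring_def by blast
qed

text \<open>Absolute values are compared with that of \<open>\<one>\<close>, which lies in
  \<open>M\<close>. The ultrafilter turns the failure of the bound by 1 into its negation almost
  everywhere, which bounds the inverse.\<close>

lemma valuation_subring_convex: "valuation_subring (star_complex U) M"
proof -
  interpret field "star_complex U" by (rule field_ultrapower[OF U])
  have sub: "subring M (star_complex U)" using M by (simp add: convex_subring_def)
  have one: "family_class U (\<lambda>_. 1) \<in> M" using subringE(3)[OF sub] by (simp add: ultrapower_simps)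
  show ?thesis
  proof (intro valuation_subring.intro valuation_subring_axioms.intro field_axioms sub)
    fix z assume z: "z \<in> carrier (star_complex U)" "z \<notin> M"
    then obtain f where f: "z = family_class U f" by (auto simp: ultrapower_simps)
    have "\<not> (\<forall>\<^sub>F i in U. cmod (f i) \<le> 1)"
      using convex_subringD[OF one, of f] z f by auto
    then have *: "\<forall>\<^sub>F i in U. \<not> cmod (f i) \<le> 1"
      by (rule eventually_not_ultrafilter[OF U])
    then have "\<forall>\<^sub>F i in U. f i \<noteq> 0" by eventually_elim auto
    moreover have "\<forall>\<^sub>F i in U. cmod (inverse (f i)) \<le> cmod 1"
      using * by eventually_elim (auto simp: norm_inverse intro: inverse_le_1_iff[THEN iffD2])
    ultimately show "inv\<^bsub>star_complex U\<^esub> z \<in> M"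
      using convex_subringD[OF one] f by (simp add: ultrapower_inv)
  qed
qed

interpretation V: valuation_subring "star_complex U" M
  by (rule valuation_subring_convex)

text \<open>With the next two equations, results on valuation rings become statements about
  \<open>asymptotic_field U M\<close> and \<open>quotient_map U M\<close>.\<close>

lemma noninvertibles_eq: "noninvertibles U M = V.nonunits"
  by (simp add: noninvertibles_def V.nonunits_def)

lemma asymptotic_field_eq: "asymptotic_field U M = V.residue_field"
  by (simp add: asymptotic_field_def noninvertibles_eq)

lemma quotient_map_eq: "quotient_map U M = V.residue"
  by (simp add: fun_eq_iff quotient_map_def noninvertibles_eq)

text \<open>Taking inverses reverses the inequality: if \<open>f\<close> gave a unit of
  \<open>M\<close>, convexity would put the inverse of the class of \<open>g\<close> into
  \<open>M\<close>. The order on the real part depends on this.\<close>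

lemma nonunits_convex:
  assumes "family_class U g \<in> V.nonunits" "\<forall>\<^sub>F i in U. cmod (f i) \<le> cmod (g i)"
  shows "family_class U f \<in> V.nonunits"
proof (rule ccontr)
  assume *: "family_class U f \<notin> V.nonunits"
  have "family_class U f \<in> M"
    using convex_subringD assms V.nonunits_subset by blast
  then have "family_class U f \<noteq> \<zero>\<^bsub>star_complex U\<^esub>"
      "inv\<^bsub>star_complex U\<^esub> (family_class U f) \<in> M"
    using V.not_nonunit[OF _ *] by blast+
  then have f: "\<forall>\<^sub>F i in U. f i \<noteq> 0" "family_class U (\<lambda>i. inverse (f i)) \<in> M"
    using ultrapower_nonzero[of f] ultrapower_inv[of f] by auto
  have g: "\<forall>\<^sub>F i in U. g i \<noteq> 0"
    using f(1) assms(2) by eventually_elim auto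
  have "\<forall>\<^sub>F i in U. cmod (inverse (g i)) \<le> cmod (inverse (f i))"
    using assms(2) f(1) by eventually_elim (simp add: norm_inverse le_imp_inverse_le)
  then have "inv\<^bsub>star_complex U\<^esub> (family_class U g) \<in> M"
    using convex_subringD[OF f(2)] ultrapower_inv[OF g] by simp
  then show False
    using assms(1) g ultrapower_nonzero[of g] by (auto simp: V.nonunits_def)
qed

section \<open>The real part: field, order, square roots and roots in odd degree\<close>

definition real_class :: "('i \<Rightarrow> real) \<Rightarrow> ('i \<Rightarrow> complex) set"
  where "real_class f = family_class U (\<lambda>i. complex_of_real (f i))"

definition real_elements :: "('i \<Rightarrow> complex) set set"
  where "real_elements = range real_class \<inter> M"

lemma star_complex_of_real_image:
  "star_complex_of_real U ` carrier (star_real U) = range real_class"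
  by (simp add: ultrapower_simps(1) image_image star_map_family_class real_class_def[abs_def])

lemma asymptotic_real_part_eq:
  "asymptotic_real_part U M = V.residue_field\<lparr>carrier := V.residue ` real_elements\<rparr>"
  by (simp add: asymptotic_real_part_def asymptotic_field_eq quotient_map_eq
      star_complex_of_real_image real_elements_def)

text \<open>Positivity is expressed through real families, and the nonvanishing of the residue
  through the representative being a unit of \<open>M\<close>.\<close>

lemma asymptotic_positive_iff:
  "x \<in> asymptotic_positive U M \<longleftrightarrow>
    (\<exists>f. x = V.residue (real_class f) \<and> real_class f \<in> M \<and> real_class f \<notin> V.nonunits \<and>
      (\<forall>\<^sub>F i in U. 0 < f i))"
proof -
  have "x \<in> asymptotic_positive U M \<longleftrightarrow> (\<exists>f. let z = star_complex_of_real U (family_class U f) in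
      x = V.residue z \<and> z \<in> M \<and> V.residue z \<noteq> \<zero>\<^bsub>V.residue_field\<^esub> \<and>
      star_rel U (<) \<zero>\<^bsub>star_real U\<^esub> (family_class U f))"
    unfolding asymptotic_positive_def asymptotic_field_eq quotient_map_eq ultrapower_simps(1) Let_def
    by blast
  also have "\<dots> \<longleftrightarrow> (\<exists>f. x = V.residue (real_class f) \<and> real_class f \<in> M \<and>
      V.residue (real_class f) \<noteq> \<zero>\<^bsub>V.residue_field\<^esub> \<and> (\<forall>\<^sub>F i in U. 0 < f i))"
    by (simp add: Let_def ultrapower_simps(5) star_map_family_class star_rel_family_class real_class_def)
  finally show ?thesis using V.residue_eq_zero_iff by blast
qed

lemma real_class_simps:
  "real_class f \<oplus>\<^bsub>star_complex U\<^esub> real_class g = real_class (\<lambda>i. f i + g i)"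
  "real_class f \<otimes>\<^bsub>star_complex U\<^esub> real_class g = real_class (\<lambda>i. f i * g i)"
  "real_class (\<lambda>_. 0) = \<zero>\<^bsub>star_complex U\<^esub>"
  "real_class (\<lambda>_. 1) = \<one>\<^bsub>star_complex U\<^esub>"
  by (simp_all add: real_class_def ultrapower_simps)

lemma real_class_convex:
  assumes "\<forall>\<^sub>F i in U. \<bar>f i\<bar> \<le> \<bar>g i\<bar>"
  shows "real_class g \<in> M \<Longrightarrow> real_class f \<in> M"
    and "real_class g \<in> V.nonunits \<Longrightarrow> real_class f \<in> V.nonunits"
  using convex_subringD nonunits_convex assms by (auto simp: real_class_def)

interpretation D: domain "(star_complex U)\<lparr>carrier := M\<rparr>"
  by (rule V.domain_M)

interpretation F: field V.residue_field
  by (rule V.field_residue_field)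

interpretation h: ring_hom_ring "(star_complex U)\<lparr>carrier := M\<rparr>" V.residue_field V.residue
  by (rule V.residue_hom)

text \<open>The real elements form a subring, as the intersection of \<open>M\<close> with the image
  of \<open>star_real U\<close>; the inverse of a real class is computed pointwise and is again
  real.\<close>

lemma subfield_real_part: "subfield (V.residue ` real_elements) V.residue_field"
proof -
  interpret R: field "star_real U" by (rule field_ultrapower[OF U])
  have "subring (range real_class) (star_complex U)"
    using ring_hom_ring.img_is_subring[OF star_complex_of_real_hom R.carrier_is_subring]
    by (simp add: star_complex_of_real_image)
  then have "subring real_elements (star_complex U)"
    using V.subring_inter V.subring_M by (simp add: real_elements_def)
  then have "ring ((star_complex U)\<lparr>carrier := real_elements\<rparr>)"
    by (rule V.subring_is_ring)
  \<comment> \<open>The residue map is a homomorphism on \<open>M\<close>, so its image theorem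
    wants a subring of the ring restricted to \<open>M\<close>.\<close>
  then have "subring real_elements ((star_complex U)\<lparr>carrier := M\<rparr>)"
    by (intro D.ring_incl_imp_subring) (auto simp: real_elements_def)
  then have sub: "subring (V.residue ` real_elements) V.residue_field"
    by (rule h.img_is_subring)
  show ?thesis
  proof (rule F.subfieldI'[OF sub])
    fix k assume k: "k \<in> V.residue ` real_elements - {\<zero>\<^bsub>V.residue_field\<^esub>}"
    then obtain f where f: "k = V.residue (real_class f)" "real_class f \<in> M"
      by (auto simp: real_elements_def)
    then have "real_class f \<notin> V.nonunits"
      using k V.residue_eq_zero_iff[OF f(2)] by auto
    then have nz: "real_class f \<noteq> \<zero>\<^bsub>star_complex U\<^esub>" and inv: "inv\<^bsub>star_complex U\<^esub> (real_class f) \<in> M"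
      using V.not_nonunit f by auto
    then have "\<forall>\<^sub>F i in U. complex_of_real (f i) \<noteq> 0"
      using ultrapower_nonzero[of "\<lambda>i. complex_of_real (f i)"] by (simp add: real_class_def)
    then have ri: "inv\<^bsub>star_complex U\<^esub> (real_class f) = real_class (\<lambda>i. inverse (f i))"
      by (simp add: real_class_def ultrapower_inv)
    have "inv\<^bsub>V.residue_field\<^esub> k = V.residue (inv\<^bsub>star_complex U\<^esub> (real_class f))"
    proof (rule F.comm_inv_char)
      have "real_class f \<otimes>\<^bsub>star_complex U\<^esub> inv\<^bsub>star_complex U\<^esub> (real_class f) = \<one>\<^bsub>star_complex U\<^esub>"
        using nz f(2) by (simp add: V.field_Units)
      then show "k \<otimes>\<^bsub>V.residue_field\<^esub> V.residue (inv\<^bsub>star_complex U\<^esub> (real_class f)) = \<one>\<^bsub>V.residue_field\<^esub>"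
        using h.hom_mult[of "real_class f" "inv\<^bsub>star_complex U\<^esub> (real_class f)"] h.hom_one f inv
        by simp
    qed (use f inv in \<open>auto simp: V.carrier_residue_field\<close>)
    then show "inv\<^bsub>V.residue_field\<^esub> k \<in> V.residue ` real_elements"
      using ri inv by (auto simp: real_elements_def)
  qed
qed

text \<open>The operation \<open>\<ominus>\<close> is defined relative to the carrier, so in the
  real part it is identified by uniqueness of additive inverses.\<close>

lemma real_part_uminus:
  assumes "real_class f \<in> M"
  shows "\<ominus>\<^bsub>asymptotic_real_part U M\<^esub> V.residue (real_class f) = V.residue (real_class (\<lambda>i. - f i))"
    and "real_class (\<lambda>i. - f i) \<in> M"
proof -
  interpret R: field "asymptotic_real_part U M"
    unfolding asymptotic_real_part_eq by (rule F.subfield_iff(2)[OF subfield_real_part])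
  show m: "real_class (\<lambda>i. - f i) \<in> M"
    using real_class_convex(1)[OF _ assms, of "\<lambda>i. - f i"] by simp
  have "V.residue (real_class (\<lambda>i. - f i)) \<oplus>\<^bsub>V.residue_field\<^esub> V.residue (real_class f) = \<zero>\<^bsub>V.residue_field\<^esub>"
    using h.hom_add[of "real_class (\<lambda>i. - f i)" "real_class f"] m assms h.hom_zero
    by (simp add: real_class_simps)
  then show "\<ominus>\<^bsub>asymptotic_real_part U M\<^esub> V.residue (real_class f) = V.residue (real_class (\<lambda>i. - f i))"
    using m assms by (intro R.minus_equality) (auto simp: asymptotic_real_part_eq real_elements_def)
qed

text \<open>For positive families \<open>f\<close> and \<open>g\<close>, \<open>f\<close> is
  dominated by \<open>f + g\<close>; since the nonunits are convex, the sum of two positive units is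
  a unit. This gives closure under addition and keeps \<open>x\<close> and its negative from both
  being positive. Products stay units because the nonunits are prime.\<close>

lemma totally_ordered_real_part:
  "totally_ordered_field (asymptotic_real_part U M) (asymptotic_positive U M)"
proof -
  interpret R: field "asymptotic_real_part U M"
    unfolding asymptotic_real_part_eq by (rule F.subfield_iff(2)[OF subfield_real_part])
  show ?thesis
  proof unfold_locales
    show "asymptotic_positive U M \<subseteq> carrier (asymptotic_real_part U M)"
      by (auto simp: asymptotic_positive_iff asymptotic_real_part_eq real_elements_def)
    show "\<zero>\<^bsub>asymptotic_real_part U M\<^esub> \<notin> asymptotic_positive U M"
      using V.residue_eq_zero_iff by (auto simp: asymptotic_positive_iff asymptotic_real_part_eq)
  next
    fix x assume x: "x \<in> carrier (asymptotic_real_part U M)" "x \<noteq> \<zero>\<^bsub>asymptotic_real_part U M\<^esub>"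
    then obtain f where f: "x = V.residue (real_class f)" "real_class f \<in> M"
      by (auto simp: asymptotic_real_part_eq real_elements_def)
    have nu: "real_class f \<notin> V.nonunits"
      using x f V.residue_eq_zero_iff by (auto simp: asymptotic_real_part_eq)
    show "x \<in> asymptotic_positive U M \<or> \<ominus>\<^bsub>asymptotic_real_part U M\<^esub> x \<in> asymptotic_positive U M"
    proof (cases "\<forall>\<^sub>F i in U. 0 < f i")
      case True
      then show ?thesis using f nu by (auto simp: asymptotic_positive_iff)
    next
      \<comment> \<open>The ultrafilter makes \<open>f\<close> nonpositive almost everywhere, and a
        unit of \<open>M\<close> is a nonzero class, so \<open>f\<close> is negative almost
        everywhere.\<close>
      case False
      have "\<forall>\<^sub>F i in U. complex_of_real (f i) \<noteq> 0"
        using V.not_nonunit[OF f(2) nu] ultrapower_nonzero[of "\<lambda>i. complex_of_real (f i)"]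
        by (simp add: real_class_def)
      with eventually_not_ultrafilter[OF U False] have "\<forall>\<^sub>F i in U. 0 < - f i"
        by eventually_elim auto
      moreover have "real_class (\<lambda>i. - f i) \<notin> V.nonunits"
        using real_class_convex(2)[of f "\<lambda>i. - f i"] nu by auto
      ultimately show ?thesis
        using real_part_uminus[OF f(2)] f(1) by (auto simp: asymptotic_positive_iff)
    qed
  next
    fix x assume x: "x \<in> asymptotic_positive U M"
    show "\<ominus>\<^bsub>asymptotic_real_part U M\<^esub> x \<notin> asymptotic_positive U M"
    proof
      assume "\<ominus>\<^bsub>asymptotic_real_part U M\<^esub> x \<in> asymptotic_positive U M"
      then obtain f g where f: "x = V.residue (real_class f)" "real_class f \<in> M"
          "real_class f \<notin> V.nonunits" "\<forall>\<^sub>F i in U. 0 < f i"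
        and g: "\<ominus>\<^bsub>asymptotic_real_part U M\<^esub> x = V.residue (real_class g)" "real_class g \<in> M"
          "\<forall>\<^sub>F i in U. 0 < g i"
        using x by (auto simp: asymptotic_positive_iff)
      have "x \<in> carrier (asymptotic_real_part U M)"
        using f by (auto simp: asymptotic_real_part_eq real_elements_def)
      then have "x \<oplus>\<^bsub>asymptotic_real_part U M\<^esub> V.residue (real_class g) = \<zero>\<^bsub>asymptotic_real_part U M\<^esub>"
        using R.r_neg g(1) by metis
      then have "V.residue (real_class (\<lambda>i. f i + g i)) = \<zero>\<^bsub>V.residue_field\<^esub>"
        using h.hom_add[of "real_class f" "real_class g"] f g
        by (simp add: asymptotic_real_part_eq real_class_simps)
      moreover have "real_class (\<lambda>i. f i + g i) \<in> M"
        using V.M_props(7)[OF f(2) g(2)] by (simp add: real_class_simps)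
      ultimately have "real_class (\<lambda>i. f i + g i) \<in> V.nonunits"
        using V.residue_eq_zero_iff by blast
      moreover have "\<forall>\<^sub>F i in U. \<bar>f i\<bar> \<le> \<bar>f i + g i\<bar>"
        using f(4) g(3) by eventually_elim auto
      ultimately show False
        using real_class_convex(2)[of f "\<lambda>i. f i + g i"] f(3) by blast
    qed
  next
    fix x y assume "x \<in> asymptotic_positive U M" "y \<in> asymptotic_positive U M"
    then obtain f g where f: "x = V.residue (real_class f)" "real_class f \<in> M"
        "real_class f \<notin> V.nonunits" "\<forall>\<^sub>F i in U. 0 < f i"
      and g: "y = V.residue (real_class g)" "real_class g \<in> M"
        "real_class g \<notin> V.nonunits" "\<forall>\<^sub>F i in U. 0 < g i"
      by (auto simp: asymptotic_positive_iff)
    have add: "real_class (\<lambda>i. f i + g i) \<in> M" and mult: "real_class (\<lambda>i. f i * g i) \<in> M"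
      using V.M_props(6,7)[OF f(2) g(2)] by (simp_all add: real_class_simps)
    have "\<forall>\<^sub>F i in U. \<bar>f i\<bar> \<le> \<bar>f i + g i\<bar>"
      using f(4) g(4) by eventually_elim auto
    then have "real_class (\<lambda>i. f i + g i) \<notin> V.nonunits"
      using real_class_convex(2)[of f "\<lambda>i. f i + g i"] f(3) by blast
    moreover have "\<forall>\<^sub>F i in U. 0 < f i + g i"
      using f(4) g(4) by eventually_elim auto
    moreover have "x \<oplus>\<^bsub>asymptotic_real_part U M\<^esub> y = V.residue (real_class (\<lambda>i. f i + g i))"
      using h.hom_add[of "real_class f" "real_class g"] f g
      by (simp add: asymptotic_real_part_eq real_class_simps)
    ultimately show "x \<oplus>\<^bsub>asymptotic_real_part U M\<^esub> y \<in> asymptotic_positive U M"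
      using add asymptotic_positive_iff by blast
    have "real_class (\<lambda>i. f i * g i) \<notin> V.nonunits"
      using V.nonunits_prime[OF f(2) g(2)] f(3) g(3) by (auto simp: real_class_simps)
    moreover have "\<forall>\<^sub>F i in U. 0 < f i * g i"
      using f(4) g(4) by eventually_elim auto
    moreover have "x \<otimes>\<^bsub>asymptotic_real_part U M\<^esub> y = V.residue (real_class (\<lambda>i. f i * g i))"
      using h.hom_mult[of "real_class f" "real_class g"] f g
      by (simp add: asymptotic_real_part_eq real_class_simps)
    ultimately show "x \<otimes>\<^bsub>asymptotic_real_part U M\<^esub> y \<in> asymptotic_positive U M"
      using mult asymptotic_positive_iff by blast
  qed
qed

text \<open>The root is taken pointwise. For \<open>f i > 0\<close> it is at most
  \<open>1 + f i\<close>, whether \<open>f i\<close> is small or large, so convexity keeps it in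
  \<open>M\<close>.\<close>

lemma real_part_square_root:
  assumes "x \<in> asymptotic_positive U M"
  shows "\<exists>y \<in> carrier (asymptotic_real_part U M). y \<otimes>\<^bsub>asymptotic_real_part U M\<^esub> y = x"
proof -
  obtain f where f: "x = V.residue (real_class f)" "real_class f \<in> M" "\<forall>\<^sub>F i in U. 0 < f i"
    using assms by (auto simp: asymptotic_positive_iff)
  have "real_class (\<lambda>i. 1 + f i) \<in> M"
    using V.M_props(7)[OF V.M_props(3) f(2)]
    unfolding real_class_simps(4)[symmetric] by (simp only: real_class_simps(1))
  moreover have "\<forall>\<^sub>F i in U. \<bar>sqrt (f i)\<bar> \<le> \<bar>1 + f i\<bar>"
    using f(3)
  proof eventually_elim
    case (elim i)
    have "f i \<le> (1 + f i)\<^sup>2" using elim by (simp add: power2_eq_square algebra_simps)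
    then show ?case using elim by (simp add: real_le_lsqrt)
  qed
  ultimately have s: "real_class (\<lambda>i. sqrt (f i)) \<in> M"
    using real_class_convex(1)[of "\<lambda>i. sqrt (f i)" "\<lambda>i. 1 + f i"] by blast
  have "real_class (\<lambda>i. sqrt (f i) * sqrt (f i)) = real_class f"
    unfolding real_class_def family_class_eq_iff using f(3) by eventually_elim simp
  then have "V.residue (real_class (\<lambda>i. sqrt (f i))) \<otimes>\<^bsub>asymptotic_real_part U M\<^esub>
      V.residue (real_class (\<lambda>i. sqrt (f i))) = x"
    using h.hom_mult[of "real_class (\<lambda>i. sqrt (f i))" "real_class (\<lambda>i. sqrt (f i))"] s f(1)
    by (simp add: asymptotic_real_part_eq real_class_simps)
  then show ?thesis
    using s by (auto simp: asymptotic_real_part_eq real_elements_def)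
qed

text \<open>The lifted coefficients are real, so a root exists already in
  \<open>star_real U\<close>; embedded into \<open>star_complex U\<close> it lies in
  \<open>M\<close> by \<open>root_in_M\<close>, and its residue is the root sought.\<close>

lemma real_part_odd_degree_root:
  assumes p: "p \<in> carrier (poly_ring (asymptotic_real_part U M))" "odd (length p - 1)"
  shows "\<exists>x \<in> carrier (asymptotic_real_part U M).
    ring.eval (asymptotic_real_part U M) p x = \<zero>\<^bsub>asymptotic_real_part U M\<^esub>"
proof -
  interpret g: ring_hom_ring "star_real U" "star_complex U" "star_complex_of_real U"
    by (rule star_complex_of_real_hom)
  have eval: "ring.eval (asymptotic_real_part U M) = F.eval"
    unfolding asymptotic_real_part_eq
    by (rule F.eval_consistent[OF subfieldE(1)[OF subfield_real_part]])
  \<comment> \<open>For \<open>[]\<close> the truncated difference \<open>length p - 1\<close> is 0,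
    which is even.\<close>
  have "p \<noteq> []" using p(2) by auto
  then have "set p \<subseteq> V.residue ` real_elements" "hd p \<noteq> \<zero>\<^bsub>V.residue_field\<^esub>"
    using p(1) by (auto simp: univ_poly_carrier[symmetric] polynomial_def asymptotic_real_part_eq)
  then obtain a as where as: "set (a # as) \<subseteq> real_elements" "a \<notin> V.nonunits"
      "p = map V.residue (a # as)"
    using V.lift_polynomial[of p real_elements] \<open>p \<noteq> []\<close> by (auto simp: real_elements_def)
  have "a # as \<in> map (star_complex_of_real U) ` lists (carrier (star_real U))"
  proof -
    have "set (a # as) \<subseteq> star_complex_of_real U ` carrier (star_real U)"
      using as(1) by (auto simp: star_complex_of_real_image real_elements_def)
    then show ?thesis by (metis in_listsI lists_image subsetD)
  qed
  then obtain b bs where b: "set (b # bs) \<subseteq> carrier (star_real U)"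
      "a # as = map (star_complex_of_real U) (b # bs)"
    by force
  have asM: "set (a # as) \<subseteq> M" using as(1) by (auto simp: real_elements_def)
  have "a \<noteq> \<zero>\<^bsub>star_complex U\<^esub>" using as V.not_nonunit[of a] asM by auto
  then have "b \<noteq> \<zero>\<^bsub>star_real U\<^esub>" using b g.hom_zero by auto
  \<comment> \<open>The lists \<open>p\<close>, \<open>a # as\<close> and \<open>b # bs\<close> have
    equal length, so \<open>length bs\<close> is the degree of \<open>p\<close>.\<close>
  moreover have "odd (length bs)" using p(2) as(3) b(2) by (auto dest: map_eq_imp_length_eq)
  ultimately obtain r where r: "r \<in> carrier (star_real U)"
      "ring.eval (star_real U) (b # bs) r = \<zero>\<^bsub>star_real U\<^esub>"
    using ultrapower_root[of bs b] real_odd_degree_root b(1) by metis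
  let ?r = "star_complex_of_real U r"
  have r': "?r \<in> carrier (star_complex U)" "V.eval (a # as) ?r = \<zero>\<^bsub>star_complex U\<^esub>"
    using g.eval_hom'[OF r(1) b(1)] r g.hom_zero b(2) by (auto simp del: V.eval.simps)
  have "?r \<in> M" using V.root_in_M[OF asM as(2) r'] .
  then have "?r \<in> real_elements"
    using r(1) star_complex_of_real_image by (auto simp: real_elements_def)
  moreover have "F.eval p (V.residue ?r) = \<zero>\<^bsub>V.residue_field\<^esub>"
    using V.residue_root[OF asM as(2) r'] as(3) by simp
  ultimately show ?thesis
    unfolding eval by (auto simp: asymptotic_real_part_eq)
qed

lemma real_closed_real_part:
  "real_closed_field (asymptotic_real_part U M) (asymptotic_positive U M)"
  using totally_ordered_real_part real_part_square_root real_part_odd_degree_root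
  by (auto simp: real_closed_field_def real_closed_field_axioms_def)

section \<open>Conclusions for asymptotic fields\<close>

lemma maximal_field_iso:
  assumes "maximal_field U M K"
  shows "quotient_map U M \<in> ring_iso ((star_complex U)\<lparr>carrier := K\<rparr>) (asymptotic_field U M)"
  unfolding quotient_map_eq asymptotic_field_eq
proof (rule V.maximal_subfield_iso[OF algebraically_closed_star_complex])
  show "subfield K (star_complex U)" "K \<subseteq> M"
    using assms by (auto simp: maximal_field_def)
  fix L assume "subfield L (star_complex U)" "K \<subseteq> L" "L \<subseteq> M"
  then show "L = K" using assms by (auto simp: maximal_field_def)
qed

lemma algebraically_closed_asymptotic_field: "algebraically_closed (asymptotic_field U M)"
  unfolding asymptotic_field_eq
  by (rule V.algebraically_closed_residue_field[OF algebraically_closed_star_complex])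

end

end

theorem theorem14p11:
  fixes U :: "'i filter" and M :: "('i \<Rightarrow> complex) set set"
  assumes "robinson_ultrafilter U"
    and "convex_subring U M"
  shows "(\<forall>K. maximal_field U M K \<longrightarrow>
            quotient_map U M \<in> ring_iso ((star_complex U)\<lparr>carrier := K\<rparr>) (asymptotic_field U M) \<and>
            carrier (asymptotic_field U M) = quotient_map U M ` K) \<and>
         algebraically_closed (asymptotic_field U M) \<and>
         real_closed_field (asymptotic_real_part U M) (asymptotic_positive U M)"
proof -
  have U: "is_ultrafilter U" using assms(1) by (simp add: robinson_ultrafilter_def)
  have "quotient_map U M \<in> ring_iso ((star_complex U)\<lparr>carrier := K\<rparr>) (asymptotic_field U M) \<and>
      carrier (asymptotic_field U M) = quotient_map U M ` K" if "maximal_field U M K" for K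
    using maximal_field_iso[OF U assms(2) that] by (auto simp: ring_iso_def bij_betw_def)
  then show ?thesis
    using algebraically_closed_asymptotic_field[OF U assms(2)] real_closed_real_part[OF U assms(2)]
    by blast
qed

end
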